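(* Let $k \geq 3$ and let $P \in \mathrm{PLS}(2,3;n)$. Let $\sigma$ be the $(1,2)$-row-permutation of $P$ and let $T=\{P(1,1),P(1,2),P(1,3)\}$. Suppose that the disjoint cycle representation of $\sigma$ consists of exactly one cycle of length $3$, whose three elements are exactly the elements of $T$, together with exactly $k+2$ cycles of length $2$, none of whose elements lies in $T$ (so that $n = 3 + 2(k+2)$). Then $P$ is completable.
   Context: $\mathrm{PLS}(2,3;n)$ denotes the set of $n\times n$ partial Latin squares on the symbols $\{1,\dots,n\}$ (each cell empty or containing one symbol, no symbol repeated in any row or column) in which rows $1$ and $2$ and columns $1,2,3$ are completely filled and all other cells are empty. The $(1,2)$-row-permutation of such $P$ is the permutation $\sigma$ of $\{1,\dots,n\}$ defined by $\sigma(P(1,i)) = P(2,i)$ for all $i \in \{1,\dots,n\}$. $P$ is completable if there is an $n\times n$ Latin square agreeing with $P$ on all nonempty cells of $P$. *)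

theory Defs
  imports Main
begin

(* An n x n partial array: rows/columns indexed by {1..n}, symbols in {1..n};
   None = empty cell. Only cells in {1..n} x {1..n} are relevant. *)
type_synonym parr = "nat \<Rightarrow> nat \<Rightarrow> nat option"

definition partial_latin :: "nat \<Rightarrow> parr \<Rightarrow> bool" where
  "partial_latin n P \<longleftrightarrow>
     (\<forall>i\<in>{1..n}. \<forall>j\<in>{1..n}. \<forall>v. P i j = Some v \<longrightarrow> v \<in> {1..n}) \<and>
     (\<forall>i\<in>{1..n}. \<forall>j\<in>{1..n}. \<forall>j'\<in>{1..n}. j \<noteq> j' \<longrightarrow> P i j \<noteq> None \<longrightarrow> P i j \<noteq> P i j') \<and>
     (\<forall>j\<in>{1..n}. \<forall>i\<in>{1..n}. \<forall>i'\<in>{1..n}. i \<noteq> i' \<longrightarrow> P i j \<noteq> None \<longrightarrow> P i j \<noteq> P i' j)"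

definition PLS23 :: "nat \<Rightarrow> parr \<Rightarrow> bool" where
  "PLS23 n P \<longleftrightarrow> partial_latin n P \<and>
     (\<forall>i\<in>{1..n}. \<forall>j\<in>{1..n}. (P i j \<noteq> None \<longleftrightarrow> (i \<in> {1,2} \<or> j \<in> {1,2,3})))"

definition latin_square :: "nat \<Rightarrow> (nat \<Rightarrow> nat \<Rightarrow> nat) \<Rightarrow> bool" where
  "latin_square n L \<longleftrightarrow>
     (\<forall>i\<in>{1..n}. \<forall>j\<in>{1..n}. L i j \<in> {1..n}) \<and>
     (\<forall>i\<in>{1..n}. inj_on (\<lambda>j. L i j) {1..n}) \<and>
     (\<forall>j\<in>{1..n}. inj_on (\<lambda>i. L i j) {1..n})"

definition completable :: "nat \<Rightarrow> parr \<Rightarrow> bool" where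
  "completable n P \<longleftrightarrow> (\<exists>L. latin_square n L \<and>
     (\<forall>i\<in>{1..n}. \<forall>j\<in>{1..n}. \<forall>v. P i j = Some v \<longrightarrow> L i j = v))"

definition row_perm :: "nat \<Rightarrow> parr \<Rightarrow> nat \<Rightarrow> nat" where
  "row_perm n P x =
     (if \<exists>i\<in>{1..n}. P 1 i = Some x
      then the (P 2 (SOME i. i \<in> {1..n} \<and> P 1 i = Some x)) else x)"

definition perm_orbit :: "(nat \<Rightarrow> nat) \<Rightarrow> nat \<Rightarrow> nat set" where
  "perm_orbit s x = {(s ^^ m) x | m. True}"

(* the cycles of the disjoint cycle representation of s as a permutation of {1..n}
   (fixed points count as cycles of length 1) *)
definition perm_cycles :: "nat \<Rightarrow> (nat \<Rightarrow> nat) \<Rightarrow> nat set set" where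
  "perm_cycles n s = perm_orbit s ` {1..n}"

end

theory Submission
  imports Defs
begin

text \<open>
  Since the three corner symbols form a cycle of the row permutation, the top left 2 x 3 block is
  a Latin rectangle on \<open>T\<close>. Hence every symbol outside \<open>T\<close> occurs three times in columns 1, 2, 3
  below row 2. Consider the bipartite graph between the symbols outside \<open>T\<close> and the columns
  4, ..., n in which a column is joined to the symbols not already used in its first two cells.
  It is regular of degree n - 5, and each symbol has exactly n - 5 rows still available to it;
  so Galvin's list colouring theorem, with rows as colours, places all symbols outside \<open>T\<close>.
  The cells left over, together with the cells below row 2 in columns 1, 2, 3 that carry a symbol
  of \<open>T\<close>, form a bipartite graph in which every row has degree 3. By Koenig it has a proper
  3-colouring, each colour must use one of the latter cells, and naming it after the symbol there
  fills the remaining cells.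
\<close>

section \<open>Edge colourings of bipartite graphs\<close>

definition proper_colouring :: "('a \<times> 'b) set \<Rightarrow> ('a \<times> 'b \<Rightarrow> 'c) \<Rightarrow> bool" where
  "proper_colouring E f \<longleftrightarrow>
     (\<forall>a b b'. (a, b) \<in> E \<longrightarrow> (a, b') \<in> E \<longrightarrow> f (a, b) = f (a, b') \<longrightarrow> b = b') \<and>
     (\<forall>a a' b. (a, b) \<in> E \<longrightarrow> (a', b) \<in> E \<longrightarrow> f (a, b) = f (a', b) \<longrightarrow> a = a')"

lemma proper_colouringD:
  assumes "proper_colouring E f"
  shows "(a, b) \<in> E \<Longrightarrow> (a, b') \<in> E \<Longrightarrow> f (a, b) = f (a, b') \<Longrightarrow> b = b'"
    and "(a, b) \<in> E \<Longrightarrow> (a', b) \<in> E \<Longrightarrow> f (a, b) = f (a', b) \<Longrightarrow> a = a'"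
  using assms unfolding proper_colouring_def by blast+

lemma finite_edge_fibres:
  assumes "finite E"
  shows "finite {b. (a, b) \<in> E}" and "finite {a. (a, b) \<in> E}"
proof -
  have "{b. (a, b) \<in> E} \<subseteq> snd ` E" "{a. (a, b) \<in> E} \<subseteq> fst ` E" by force+
  then show "finite {b. (a, b) \<in> E}" "finite {a. (a, b) \<in> E}"
    using assms by (meson finite_imageI finite_subset)+
qed

lemma ex_unused_colour:
  fixes g :: "'a \<Rightarrow> nat"
  assumes "finite A" "card A < d"
  shows "\<exists>c<d. c \<notin> g ` A"
proof (rule ccontr)
  assume "\<not> ?thesis"
  then have "{..<d} \<subseteq> g ` A" by auto
  then have "d \<le> card (g ` A)"
    using card_mono[of "g ` A" "{..<d}"] assms(1) by simp
  also have "\<dots> \<le> card A" using assms(1) by (rule card_image_le)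
  finally show False using assms(2) by simp
qed

text \<open>Edges are added one at a time. For the new edge \<open>(r, j)\<close> some colour
  \<open>\<alpha>\<close> is missing at \<open>r\<close> and some \<open>\<beta>\<close> at
  \<open>j\<close>; exchanging the two along the alternating path from \<open>r\<close> makes
  \<open>\<beta>\<close> missing at both ends.\<close>

theorem konig_edge_colouring:
  assumes "finite E"
    and "\<And>a. card {b. (a, b) \<in> E} \<le> d" and "\<And>b. card {a. (a, b) \<in> E} \<le> d"
  shows "\<exists>f. proper_colouring E f \<and> (\<forall>e\<in>E. f e < d)"
  using assms
proof (induction E rule: finite_induct)
  case empty
  then show ?case by (simp add: proper_colouring_def)
next
  case (insert e E)
  obtain r j where e: "e = (r, j)" by (cases e)
  have fin: "finite {b. (a, b) \<in> E}" "finite {a. (a, b) \<in> E}" for a b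
    using finite_edge_fibres[OF insert.hyps(1)] by blast+
  have fin': "finite {b. (a, b) \<in> insert e E}" "finite {a. (a, b) \<in> insert e E}" for a b
    using finite_edge_fibres[of "insert e E"] insert.hyps(1) by blast+
  have "card {b. (a, b) \<in> E} \<le> d" "card {a. (a, b) \<in> E} \<le> d" for a b
    using insert.prems(1)[of a] insert.prems(2)[of b]
      card_mono[OF fin'(1)[of a], of "{b. (a, b) \<in> E}"]
      card_mono[OF fin'(2)[of b], of "{a. (a, b) \<in> E}"] by fastforce+
  then obtain f where f: "proper_colouring E f" and fd: "\<And>e. e \<in> E \<Longrightarrow> f e < d"
    using insert.IH by blast
  have "{b. (r, b) \<in> insert e E} = insert j {b. (r, b) \<in> E}" "j \<notin> {b. (r, b) \<in> E}"
    "{a. (a, j) \<in> insert e E} = insert r {a. (a, j) \<in> E}" "r \<notin> {a. (a, j) \<in> E}"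
    using insert.hyps(2) e by auto
  then have "card {b. (r, b) \<in> E} < d" "card {a. (a, j) \<in> E} < d"
    using insert.prems(1)[of r] insert.prems(2)[of j] fin by simp_all
  then obtain \<alpha> \<beta> where \<alpha>: "\<alpha> < d" "\<alpha> \<notin> (\<lambda>b. f (r, b)) ` {b. (r, b) \<in> E}"
    and \<beta>: "\<beta> < d" "\<beta> \<notin> (\<lambda>a. f (a, j)) ` {a. (a, j) \<in> E}"
    using ex_unused_colour fin by metis
  \<comment> \<open>\<open>C\<close> holds the rows of the Kempe chain from \<open>r\<close>. It never reaches column \<open>j\<close>, as it enters
    columns only along edges of colour \<open>\<beta>\<close>.\<close>
  define step where "step = {(x, y). \<exists>b. (x, b) \<in> E \<and> f (x, b) = \<beta> \<and> (y, b) \<in> E \<and> f (y, b) = \<alpha>}"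
  define C where "C = {y. (r, y) \<in> step\<^sup>*}"
  \<comment> \<open>The two colours may coincide; \<open>sw\<close> is then the identity.\<close>
  define sw where "sw c = (if c = \<alpha> then \<beta> else if c = \<beta> then \<alpha> else c)" for c
  have sw_inj: "sw c = sw c' \<Longrightarrow> c = c'" for c c'
    by (auto simp: sw_def split: if_splits)
  define f' where "f' = (\<lambda>(x, b). if (x, b) = (r, j) then \<beta> else if x \<in> C then sw (f (x, b)) else f (x, b))"
  have rC: "r \<in> C" by (simp add: C_def)
  \<comment> \<open>A row other than \<open>r\<close> enters the chain through its
    \<open>\<alpha>\<close>-edge, and a row has only one such edge, so the column of entry is
    \<open>b\<close>.\<close>
  have backward: "\<exists>x\<in>C. (x, b) \<in> E \<and> f (x, b) = \<beta>" if y: "y \<in> C" "(y, b) \<in> E" "f (y, b) = \<alpha>" for y b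
  proof -
    have "y \<noteq> r" using y \<alpha>(2) by auto
    then obtain x where x: "(r, x) \<in> step\<^sup>*" "(x, y) \<in> step"
      using y(1) unfolding C_def by (metis mem_Collect_eq rtranclE)
    then obtain b' where "(x, b') \<in> E" "f (x, b') = \<beta>" "(y, b') \<in> E" "f (y, b') = \<alpha>"
      by (auto simp: step_def)
    moreover from this have "b' = b" using proper_colouringD(1)[OF f] y by metis
    ultimately show ?thesis using x by (auto simp: C_def)
  qed
  have forward: "y \<in> C" if "x \<in> C" "(x, b) \<in> E" "f (x, b) = \<beta>" "(y, b) \<in> E" "f (y, b) = \<alpha>" for x y b
    using that unfolding C_def step_def by (auto intro: rtrancl_into_rtrancl)
  \<comment> \<open>At a column, the edges of colours \<open>\<alpha>\<close> and
    \<open>\<beta>\<close> are exchanged together or not at all. At a row this is automatic, as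
    \<open>C\<close> consists of rows.\<close>
  have chain: "x \<in> C \<longleftrightarrow> y \<in> C"
    if "(x, b) \<in> E" "(y, b) \<in> E" "f (x, b) \<in> {\<alpha>, \<beta>}" "f (y, b) \<in> {\<alpha>, \<beta>}" for x y b
  proof (cases "x = y")
    case False
    then have ne: "f (x, b) \<noteq> f (y, b)" using proper_colouringD(2)[OF f] that by metis
    have *: "u \<in> C \<longleftrightarrow> v \<in> C"
      if "(u, b) \<in> E" "(v, b) \<in> E" "f (u, b) = \<beta>" "f (v, b) = \<alpha>" for u v
      using forward[OF _ that(1,3,2,4)] backward[OF _ that(2,4)] proper_colouringD(2)[OF f that(1)] that
      by metis
    show ?thesis using ne that *[of x y] *[of y x] by auto
  qed simp
  have old: "f' (x, b) = (if x \<in> C then sw (f (x, b)) else f (x, b))" if "(x, b) \<in> E" for x b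
    using that insert.hyps(2) e by (auto simp: f'_def)
  have new: "f' (r, j) = \<beta>" by (simp add: f'_def)
  have row_r: "f' (r, b) \<noteq> \<beta>" if "(r, b) \<in> E" for b
    using that \<alpha>(2) rC by (auto simp: old sw_def image_iff)
  \<comment> \<open>The exchange could create \<open>\<beta>\<close> at \<open>j\<close> only from
    an \<open>\<alpha>\<close>-edge of the chain, which would have been reached through a
    \<open>\<beta>\<close>-edge at \<open>j\<close>.\<close>
  have col_j: "f' (x, j) \<noteq> \<beta>" if x: "(x, j) \<in> E" for x
  proof
    assume "f' (x, j) = \<beta>"
    moreover have "f (x, j) \<noteq> \<beta>" using x \<beta>(2) by auto
    ultimately have "x \<in> C" "f (x, j) = \<alpha>" using x by (auto simp: old sw_def split: if_splits)
    then show False using backward[of x j] x \<beta>(2) by auto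
  qed
  have rows: "b = b'" if "(x, b) \<in> E" "(x, b') \<in> E" "f' (x, b) = f' (x, b')" for x b b'
    using that proper_colouringD(1)[OF f] sw_inj by (metis old)
  have cols: "x = y" if xy: "(x, b) \<in> E" "(y, b) \<in> E" "f' (x, b) = f' (y, b)" for x y b
  proof -
    have "f (x, b) = f (y, b)"
    proof (cases "x \<in> C \<longleftrightarrow> y \<in> C")
      case True
      then show ?thesis using xy(3) sw_inj unfolding old[OF xy(1)] old[OF xy(2)] by metis
    next
      case False
      then have "f (x, b) \<notin> {\<alpha>, \<beta>} \<or> f (y, b) \<notin> {\<alpha>, \<beta>}" using chain[OF xy(1,2)] by blast
      \<comment> \<open>\<open>sw\<close> fixes every colour outside the pair and maps the pair to
        itself, so a swap on one side only cannot make two different colours equal here.\<close>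
      then show ?thesis using False xy(3) unfolding old[OF xy(1)] old[OF xy(2)]
        by (cases "x \<in> C") (auto simp: sw_def split: if_splits)
    qed
    then show ?thesis using proper_colouringD(2)[OF f] xy by metis
  qed
  have "proper_colouring (insert e E) f'"
    unfolding proper_colouring_def e
  proof (intro conjI allI impI)
    fix x b b' assume *: "(x, b) \<in> insert (r, j) E" "(x, b') \<in> insert (r, j) E" "f' (x, b) = f' (x, b')"
    consider "(x, b) \<in> E" "(x, b') \<in> E" | "x = r" "b = j" "b' = j"
      | "x = r" "b = j" "(r, b') \<in> E" | "x = r" "b' = j" "(r, b) \<in> E"
      using *(1,2) by blast
    then show "b = b'"
      using *(3) rows row_r new by cases metis+
  next
    fix x y b assume *: "(x, b) \<in> insert (r, j) E" "(y, b) \<in> insert (r, j) E" "f' (x, b) = f' (y, b)"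
    consider "(x, b) \<in> E" "(y, b) \<in> E" | "b = j" "x = r" "y = r"
      | "b = j" "x = r" "(y, j) \<in> E" | "b = j" "y = r" "(x, j) \<in> E"
      using *(1,2) by blast
    then show "x = y"
      using *(3) cols col_j new by cases metis+
  qed
  moreover have "f' e' < d" if "e' \<in> insert e E" for e'
  proof (cases "e' = e")
    case False
    then have "e' \<in> E" using that by simp
    then show ?thesis using fd[of e'] \<alpha>(1) \<beta>(1) by (cases e') (auto simp: old sw_def)
  qed (use new e \<beta>(1) in simp)
  ultimately show ?case by blast
qed

section \<open>Stable matchings and Galvin's theorem\<close>

text \<open>These are the out-neighbours of \<open>e\<close> in an orientation of the line graph:
  first ends prefer small \<open>h\<close>, second ends large \<open>h\<close>. The opposite
  preferences are what keeps the total number of dominators below the number of colours.\<close>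

definition dominators :: "('a \<times> 'b \<Rightarrow> nat) \<Rightarrow> ('a \<times> 'b) set \<Rightarrow> 'a \<times> 'b \<Rightarrow> ('a \<times> 'b) set" where
  "dominators h E e =
     {e' \<in> E. (fst e' = fst e \<and> h e' < h e) \<or> (snd e' = snd e \<and> h e < h e')}"

definition matching :: "('a \<times> 'b) set \<Rightarrow> bool" where
  "matching M \<longleftrightarrow> inj_on fst M \<and> inj_on snd M"

text \<open>This is the Gale-Shapley theorem, giving a kernel of the oriented line graph. If the
  favourite edges of the first ends do not collide at a second end, they form \<open>M\<close>;
  otherwise the loser of a collision is deleted and induction applies.\<close>

lemma stable_matching_exists:
  assumes "finite E" "proper_colouring E h"
  shows "\<exists>M\<subseteq>E. matching M \<and> (\<forall>e\<in>E - M. dominators h E e \<inter> M \<noteq> {})"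
  using assms
proof (induction "card E" arbitrary: E rule: less_induct)
  case less
  define B where "B = {e \<in> E. \<forall>e'\<in>E. fst e' = fst e \<longrightarrow> h e \<le> h e'}"
  have best: "\<exists>e'\<in>B. fst e' = fst e \<and> h e' \<le> h e" if "e \<in> E" for e
  proof -
    let ?A = "{e' \<in> E. fst e' = fst e}"
    have "finite ?A" "e \<in> ?A" using less.prems(1) that by auto
    then obtain e' where "e' \<in> ?A" "\<And>e''. e'' \<in> ?A \<Longrightarrow> h e' \<le> h e''"
      by (metis (no_types, lifting) arg_min_if_finite(1) arg_min_least empty_iff)
    then have "e' \<in> B \<and> fst e' = fst e \<and> h e' \<le> h e" using that by (simp add: B_def)
    then show ?thesis by blast
  qed
  have h_fst: "e = e'" if "e \<in> E" "e' \<in> E" "fst e = fst e'" "h e = h e'" for e e'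
    using that proper_colouringD(1)[OF less.prems(2)] by (metis prod.collapse)
  have h_snd: "e = e'" if "e \<in> E" "e' \<in> E" "snd e = snd e'" "h e = h e'" for e e'
    using that proper_colouringD(2)[OF less.prems(2)] by (metis prod.collapse)
  have inj_fst: "inj_on fst B"
    using h_fst by (intro inj_onI) (force simp: B_def intro: antisym)
  show ?case
  proof (cases "inj_on snd B")
    case True
    have "dominators h E e \<inter> B \<noteq> {}" if e: "e \<in> E - B" for e
    proof -
      obtain e' where "e' \<in> B" "fst e' = fst e" "h e' \<le> h e" using best e by blast
      moreover from this have "h e' \<noteq> h e" using h_fst[of e' e] e by (auto simp: B_def)
      ultimately show ?thesis by (force simp: dominators_def B_def)
    qed
    then show ?thesis using True inj_fst by (intro exI[of _ B]) (auto simp: matching_def B_def)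
  next
    case False
    \<comment> \<open>\<open>e2\<close> may be deleted: whatever keeps \<open>e1\<close>, the best edge at its first end, out of \<open>M\<close> also
      dominates \<open>e2\<close>.\<close>
    then obtain e1 e2 where e12: "e1 \<in> B" "e2 \<in> B" "snd e1 = snd e2" "h e2 < h e1"
      using h_snd unfolding inj_on_def B_def by (metis (no_types, lifting) mem_Collect_eq nat_neq_iff)
    have inE: "e1 \<in> E" "e2 \<in> E" using e12 by (auto simp: B_def)
    have "proper_colouring (E - {e2}) h"
      using less.prems(2) unfolding proper_colouring_def by blast
    moreover have "card (E - {e2}) < card E"
      using inE less.prems(1) by (meson card_Diff1_less)
    ultimately obtain M where M: "M \<subseteq> E - {e2}" "matching M"
      "\<And>e. e \<in> E - {e2} - M \<Longrightarrow> dominators h (E - {e2}) e \<inter> M \<noteq> {}"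
      using less.hyps less.prems(1) by (metis finite_Diff)
    have dom2: "dominators h E e2 \<inter> M \<noteq> {}"
    proof (cases "e1 \<in> M")
      case True
      then show ?thesis using e12 inE by (auto simp: dominators_def)
    next
      case False
      then obtain e where "e \<in> M" "e \<in> dominators h (E - {e2}) e1"
        using M(3)[of e1] inE e12(4) by fastforce
      moreover from this have "\<not> (fst e = fst e1 \<and> h e < h e1)"
        using e12(1) by (auto simp: dominators_def B_def)
      ultimately show ?thesis using e12 by (auto simp: dominators_def)
    qed
    have "dominators h E e \<inter> M \<noteq> {}" if "e \<in> E - M" for e
    proof (cases "e = e2")
      case False
      then have "dominators h (E - {e2}) e \<inter> M \<noteq> {}" using M(3) that by blast
      then show ?thesis by (auto simp: dominators_def)
    qed (use dom2 in simp)
    then show ?thesis using M by blast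
  qed
qed

text \<open>Among the edges whose list contains \<open>c\<close>, a kernel \<open>M\<close> receives
  \<open>c\<close>. Every other such edge loses \<open>c\<close> from its list but also a dominator
  in \<open>M\<close>, so the strict inequality survives the removal of \<open>M\<close>.\<close>

lemma list_colouring_of_dominators:
  assumes "finite E" "proper_colouring E h"
    and "\<And>e. e \<in> E \<Longrightarrow> finite (L e) \<and> card (dominators h E e) < card (L e)"
  shows "\<exists>g. proper_colouring E g \<and> (\<forall>e\<in>E. g e \<in> L e)"
  using assms
proof (induction "card E" arbitrary: E L rule: less_induct)
  case less
  show ?case
  proof (cases "E = {}")
    case True
    then show ?thesis by (simp add: proper_colouring_def)
  next
    case False
    then obtain e0 where e0: "e0 \<in> E" by blast
    then have "L e0 \<noteq> {}" using less.prems(3)[of e0] by auto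
    then obtain c where c: "c \<in> L e0" by blast
    define Ec where "Ec = {e \<in> E. c \<in> L e}"
    have "finite Ec" "proper_colouring Ec h"
      using less.prems(1,2) unfolding proper_colouring_def Ec_def by auto
    then obtain M where M: "M \<subseteq> Ec" "matching M"
      "\<forall>e\<in>Ec - M. dominators h Ec e \<inter> M \<noteq> {}"
      using stable_matching_exists[of Ec h] by metis
    have ME: "M \<subseteq> E" using M(1) by (auto simp: Ec_def)
    \<comment> \<open>An empty \<open>M\<close> would leave \<open>e0\<close> undominated. Hence
      edges are really removed and the induction descends.\<close>
    have "e0 \<in> Ec" using e0 c by (simp add: Ec_def)
    then have "M \<noteq> {}" using M(3) by auto
    then have "card (E - M) < card E"
      using ME less.prems(1) by (intro psubset_card_mono) auto
    moreover have "proper_colouring (E - M) h"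
      using less.prems(2) unfolding proper_colouring_def by blast
    moreover have "finite (L e - {c}) \<and> card (dominators h (E - M) e) < card (L e - {c})"
      if e: "e \<in> E - M" for e
    proof -
      have sub: "dominators h (E - M) e \<subseteq> dominators h E e" by (auto simp: dominators_def)
      have fin: "finite (dominators h E e)" using less.prems(1) by (simp add: dominators_def)
      show ?thesis
      proof (cases "c \<in> L e")
        case True
        then obtain e' where e': "e' \<in> M" "e' \<in> dominators h Ec e"
          using M(3) e by (force simp: Ec_def)
        then have "e' \<in> dominators h E e" "e' \<notin> dominators h (E - M) e"
          by (auto simp: dominators_def Ec_def)
        then have "card (dominators h (E - M) e) < card (dominators h E e)"
          using sub fin by (metis psubsetI psubset_card_mono)
        then show ?thesis using less.prems(3)[of e] e True by auto
      next
        case False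
        then show ?thesis using less.prems(3)[of e] e card_mono[OF fin sub] by auto
      qed
    qed
    ultimately obtain g where g: "proper_colouring (E - M) g" "\<And>e. e \<in> E - M \<Longrightarrow> g e \<in> L e - {c}"
      using less.hyps[of "E - M" "\<lambda>e. L e - {c}"] less.prems(1) by blast
    define g' where "g' e = (if e \<in> M then c else g e)" for e
    have gc: "g e \<noteq> c" if "e \<in> E" "e \<notin> M" for e using g(2)[of e] that by blast
    have "proper_colouring E g'"
      unfolding proper_colouring_def
    proof (intro conjI allI impI)
      fix a b b' assume *: "(a, b) \<in> E" "(a, b') \<in> E" "g' (a, b) = g' (a, b')"
      show "b = b'"
      proof (cases "(a, b) \<in> M")
        case True
        then have "(a, b') \<in> M" using * gc by (metis g'_def)
        then show ?thesis using True M(2) by (fastforce simp: matching_def inj_on_def)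
      next
        case False
        then have "(a, b') \<notin> M" using * gc by (metis g'_def)
        then show ?thesis using False * proper_colouringD(1)[OF g(1), of a b b'] by (simp add: g'_def)
      qed
    next
      fix a a' b assume *: "(a, b) \<in> E" "(a', b) \<in> E" "g' (a, b) = g' (a', b)"
      show "a = a'"
      proof (cases "(a, b) \<in> M")
        case True
        then have "(a', b) \<in> M" using * gc by (metis g'_def)
        then show ?thesis using True M(2) by (fastforce simp: matching_def inj_on_def)
      next
        case False
        then have "(a', b) \<notin> M" using * gc by (metis g'_def)
        then show ?thesis using False * proper_colouringD(2)[OF g(1), of a b a'] by (simp add: g'_def)
      qed
    qed
    moreover have "g' e \<in> L e" if "e \<in> E" for e
      using that g(2)[of e] M(1) by (auto simp: g'_def Ec_def)
    ultimately show ?thesis by blast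
  qed
qed

text \<open>Under a Koenig colouring with \<open>d\<close> colours, an edge of colour
  \<open>i\<close> has at most \<open>i\<close> dominators at its first end and
  \<open>d - 1 - i\<close> at its second, hence fewer than \<open>d\<close>.\<close>

theorem galvin_list_edge_colouring:
  assumes "finite E"
    and "\<And>a. card {b. (a, b) \<in> E} \<le> d" and "\<And>b. card {a. (a, b) \<in> E} \<le> d"
    and "\<And>e. e \<in> E \<Longrightarrow> finite (L e) \<and> d \<le> card (L e)"
  shows "\<exists>g. proper_colouring E g \<and> (\<forall>e\<in>E. g e \<in> L e)"
proof -
  obtain h where h: "proper_colouring E h" "\<And>e. e \<in> E \<Longrightarrow> h e < d"
    using konig_edge_colouring[OF assms(1-3)] by blast
  have "card (dominators h E e) < card (L e)" if e: "e \<in> E" for e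
  proof -
    let ?A = "{e' \<in> E. fst e' = fst e \<and> h e' < h e}"
    let ?B = "{e' \<in> E. snd e' = snd e \<and> h e < h e'}"
    have "inj_on h ?A"
      using proper_colouringD(1)[OF h(1)] by (fastforce simp: inj_on_def)
    moreover have "inj_on h ?B"
      using proper_colouringD(2)[OF h(1)] by (fastforce simp: inj_on_def)
    moreover have "h ` ?A \<subseteq> {..<h e}" "h ` ?B \<subseteq> {h e<..<d}" using h(2) by auto
    ultimately have "card ?A \<le> h e" "card ?B \<le> d - Suc (h e)"
      using card_inj_on_le[of h ?A "{..<h e}"] card_inj_on_le[of h ?B "{h e<..<d}"] by auto
    moreover have "dominators h E e = ?A \<union> ?B" by (auto simp: dominators_def)
    ultimately have "card (dominators h E e) \<le> h e + (d - Suc (h e))"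
      using card_Un_le[of ?A ?B] by simp
    then show ?thesis using h(2)[OF e] conjunct2[OF assms(4)[OF e]] by linarith
  qed
  then show ?thesis using list_colouring_of_dominators[OF assms(1) h(1)] assms(4) by blast
qed


section \<open>Completion when the corner is a Latin rectangle\<close>

text \<open>With injectivity of row 2, \<open>corner\<close> forces rows 1 and 2 to carry the same
  three symbols in columns 1, 2, 3. Below row 2 these columns then contain each of the three once
  and every other symbol three times.\<close>

lemma completable_of_latin_corner:
  assumes n: "3 \<le> n" and P: "PLS23 n P"
    and corner: "\<And>q. q \<in> {1, 2, 3} \<Longrightarrow> P 2 q \<in> P 1 ` {1, 2, 3}"
  shows "completable n P"
proof -
  \<comment> \<open>Only values on filled cells matter; \<open>the None\<close> is unspecified, so
    the facts about \<open>p\<close> are restricted to those cells.\<close>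
  define p where "p r j = the (P r j)" for r j
  define N where "N = {1..n}"
  define U where "U = {3..n}"
  define J where "J = {4..n}"
  define Q where "Q = {1, 2, 3 :: nat}"
  define T where "T = p 1 ` Q"
  define V where "V = N - T"
  have N_rows: "N = {1, 2} \<union> U" "{1, 2} \<inter> U = {}" and N_cols: "N = Q \<union> J" "Q \<inter> J = {}"
    using n by (auto simp: N_def U_def J_def Q_def)
  have sub: "U \<subseteq> N" "J \<subseteq> N" "Q \<subseteq> N" using N_rows(1) N_cols(1) by blast+
  have J_diff: "J = N - Q" using N_cols by blast
  have fin: "finite N" "finite U" "finite J" "finite Q" "finite T" "finite V"
    by (simp_all add: N_def U_def J_def Q_def T_def V_def)
  have cards: "card N = n" "card U = n - 2" "card J = n - 3" "card Q = 3"
    by (simp_all add: N_def U_def J_def Q_def)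
  have latin: "partial_latin n P"
    and filled: "\<And>r j. r \<in> N \<Longrightarrow> j \<in> N \<Longrightarrow> P r j \<noteq> None \<longleftrightarrow> r \<in> {1, 2} \<or> j \<in> Q"
    using P unfolding PLS23_def N_def Q_def by auto
  have some: "P r j = Some (p r j)" if "r \<in> N" "j \<in> N" "r \<in> {1, 2} \<or> j \<in> Q" for r j
    using filled[OF that(1,2)] that(3) by (auto simp: p_def)
  have rng: "p r j \<in> N" if "r \<in> N" "j \<in> N" "r \<in> {1, 2} \<or> j \<in> Q" for r j
    using latin some[OF that] that(1,2) unfolding partial_latin_def N_def by blast
  have row_inj: "j = j'"
    if "r \<in> N" "j \<in> N" "j' \<in> N" "r \<in> {1, 2} \<or> j \<in> Q \<and> j' \<in> Q" "p r j = p r j'" for r j j'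
  proof -
    have "P r j = Some (p r j)" "P r j' = Some (p r j')" using some[of r j] some[of r j'] that by blast+
    then show ?thesis using latin that unfolding partial_latin_def N_def by (metis option.distinct(1))
  qed
  have col_inj: "r = r'"
    if "r \<in> N" "r' \<in> N" "j \<in> N" "j \<in> Q \<or> r \<in> {1, 2} \<and> r' \<in> {1, 2}" "p r j = p r' j" for r r' j
  proof -
    have "P r j = Some (p r j)" "P r' j = Some (p r' j)" using some[of r j] some[of r' j] that by blast+
    then show ?thesis using latin that unfolding partial_latin_def N_def by (metis option.distinct(1))
  qed
  have rows12: "inj_on (p r) N" "p r ` N = N" if "r \<in> {1, 2}" for r
  proof -
    have "r \<in> N" using that N_rows by auto
    then show inj: "inj_on (p r) N" using row_inj that by (auto simp: inj_on_def)
    show "p r ` N = N" using rng[OF \<open>r \<in> N\<close>] that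
      by (intro endo_inj_surj[OF fin(1) _ inj]) auto
  qed
  have row_Q: "inj_on (p r) Q" if "r \<in> N" for r
    using row_inj[OF that] N_cols by (auto simp: inj_on_def)
  have cols: "(\<lambda>r. p r q) ` N = N" if "q \<in> Q" for q
  proof (rule endo_inj_surj[OF fin(1)])
    have q: "q \<in> N" using that N_cols by auto
    show "(\<lambda>r. p r q) ` N \<subseteq> N" using rng that q by auto
    show "inj_on (\<lambda>r. p r q) N" using col_inj that q by (auto simp: inj_on_def)
  qed
  have in12: "1 \<in> N" "2 \<in> N" using N_rows by auto
  have card_T: "card T = 3" unfolding T_def using row_Q[OF in12(1)] cards by (simp add: card_image)
  have T2: "p 2 ` Q = T"
  proof (rule card_subset_eq[OF fin(5)])
    show "p 2 ` Q \<subseteq> T"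
    proof
      fix x assume "x \<in> p 2 ` Q"
      then obtain q where q: "q \<in> Q" "x = p 2 q" by blast
      then obtain q' where "q' \<in> Q" "P 2 q = P 1 q'" using corner[of q] by (auto simp: Q_def)
      then show "x \<in> T" using q by (auto simp: T_def p_def)
    qed
    show "card (p 2 ` Q) = card T" using row_Q[OF in12(2)] cards card_T by (simp add: card_image)
  qed
  have pT: "p i q \<in> T" if "i \<in> {1, 2}" "q \<in> Q" for i q
    using that imageI[of q Q "p 1"] imageI[of q Q "p 2"] T2 by (auto simp: T_def)
  have TN: "T \<subseteq> N" unfolding T_def using rng in12 N_cols by auto
  have card_V: "card V = n - 3" unfolding V_def using TN fin cards card_T by (simp add: card_Diff_subset)
  have pJ: "p r ` J = V" "inj_on (p r) J" if "r \<in> {1, 2}" for r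
  proof -
    have "p r ` Q = T" using that T2 by (auto simp: T_def)
    then show "p r ` J = V"
      unfolding J_diff V_def using rows12[OF that] N_cols
      by (subst inj_on_image_set_diff[OF rows12(1)[OF that]]) auto
    show "inj_on (p r) J" using rows12(1)[OF that] J_diff by (auto intro: inj_on_subset)
  qed
  have im: "p 1 ` J = V" "p 2 ` J = V" and inj12: "inj_on (p 1) J" "inj_on (p 2) J"
    using pJ by blast+

  \<comment> \<open>Placing the symbols outside \<open>T\<close> by list colouring\<close>
  \<comment> \<open>An edge \<open>(v, j)\<close> is an occurrence of \<open>v\<close> that column
    \<open>j\<close> still lacks. Its colour will be the row that receives it, and
    \<open>free v\<close> is its list.\<close>
  define E where "E = {(v, j). v \<in> V \<and> j \<in> J \<and> v \<noteq> p 1 j \<and> v \<noteq> p 2 j}"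
  define free where "free v = {r \<in> U. v \<notin> p r ` Q}" for v
  have "E \<subseteq> V \<times> J" by (auto simp: E_def)
  then have fin_E: "finite E" using fin by (meson finite_SigmaI finite_subset)
  \<comment> \<open>Rows 1 and 2 show \<open>v\<close> once each within the \<open>n - 3\<close>
    columns of \<open>J\<close>, and in different columns.\<close>
  have deg_v: "card {j. (v, j) \<in> E} = n - 5" if v: "v \<in> V" for v
  proof -
    obtain j1 j2 where j: "j1 \<in> J" "p 1 j1 = v" "j2 \<in> J" "p 2 j2 = v"
      using v im by (metis imageE)
    have "j1 \<noteq> j2" using j col_inj[of 1 2 j1] in12 N_cols by auto
    moreover have "v = p 1 j \<longleftrightarrow> j = j1" "v = p 2 j \<longleftrightarrow> j = j2" if "j \<in> J" for j
      using j that inj_onD[OF inj12(1)] inj_onD[OF inj12(2)] by metis+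
    then have "{j. (v, j) \<in> E} = J - {j1, j2}"
      using v unfolding E_def by blast
    ultimately show ?thesis using j fin cards by (simp add: card_Diff_subset)
  qed
  have deg_j: "card {v. (v, j) \<in> E} = n - 5" if j: "j \<in> J" for j
  proof -
    have "p 1 j \<noteq> p 2 j" using j col_inj[of 1 2 j] in12 N_cols by auto
    moreover have "p 1 j \<in> V" "p 2 j \<in> V" using j im by blast+
    moreover have "{v. (v, j) \<in> E} = V - {p 1 j, p 2 j}" using j by (auto simp: E_def)
    ultimately show ?thesis using fin card_V by (simp add: card_Diff_subset)
  qed
  \<comment> \<open>As \<open>v\<close> does not occur in the corner, its occurrences in the three
    columns of \<open>Q\<close> take up three distinct rows among the \<open>n - 2\<close> rows of
    \<open>U\<close>.\<close>
  have card_free: "card (free v) = n - 5" if v: "v \<in> V" for v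
  proof -
    have "\<forall>q\<in>Q. \<exists>r\<in>N. p r q = v" using cols v by (auto simp: V_def) (metis imageE)
    then obtain \<rho> where \<rho>: "\<And>q. q \<in> Q \<Longrightarrow> \<rho> q \<in> N \<and> p (\<rho> q) q = v" by metis
    have \<rho>U: "\<rho> q \<in> U" if "q \<in> Q" for q
    proof (rule ccontr)
      assume "\<rho> q \<notin> U"
      then have "\<rho> q \<in> {1, 2}" using \<rho>[OF that] N_rows by blast
      then have "p (\<rho> q) q \<in> T" using pT that by blast
      then show False using \<rho>[OF that] v by (simp add: V_def)
    qed
    have "inj_on \<rho> Q" using \<rho> row_Q by (auto simp: inj_on_def) metis+
    then have "card (\<rho> ` Q) = 3" using cards by (simp add: card_image)
    moreover have "free v = U - \<rho> ` Q"
    proof -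
      have "r = \<rho> q" if "r \<in> U" "q \<in> Q" "v = p r q" for r q
        using col_inj[of r "\<rho> q" q] that \<rho>[of q] N_rows N_cols by auto
      then show ?thesis using \<rho> by (auto simp: free_def)
    qed
    moreover have "\<rho> ` Q \<subseteq> U" using \<rho>U by auto
    ultimately show ?thesis using fin cards by (simp add: card_Diff_subset)
  qed
  have "\<exists>g. proper_colouring E g \<and> (\<forall>e\<in>E. g e \<in> (free \<circ> fst) e)"
  proof (rule galvin_list_edge_colouring[OF fin_E, of "n - 5"])
    show "card {b. (a, b) \<in> E} \<le> n - 5" for a
      using deg_v[of a] by (cases "a \<in> V") (auto simp: E_def)
    show "card {a. (a, b) \<in> E} \<le> n - 5" for b
      using deg_j[of b] by (cases "b \<in> J") (auto simp: E_def)
    show "finite ((free \<circ> fst) e) \<and> n - 5 \<le> card ((free \<circ> fst) e)" if "e \<in> E" for e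
      using that card_free fin by (auto simp: E_def free_def)
  qed
  then obtain R where R: "proper_colouring E R" "\<And>v j. (v, j) \<in> E \<Longrightarrow> R (v, j) \<in> free v"
    by fastforce
  define at where "at r j v \<longleftrightarrow> (v, j) \<in> E \<and> R (v, j) = r" for r j v
  have at_unique: "at r j v \<Longrightarrow> at r j v' \<Longrightarrow> v = v'" "at r j v \<Longrightarrow> at r j' v \<Longrightarrow> j = j'" for r j j' v v'
    using proper_colouringD[OF R(1)] unfolding at_def by metis+
  have at_colunique: "at r j v \<Longrightarrow> at r' j v \<Longrightarrow> r = r'" for r r' j v by (simp add: at_def)
  have at_V: "v \<in> V" "j \<in> J" "r \<in> U" "v \<notin> p r ` Q" "v \<noteq> p 1 j" "v \<noteq> p 2 j" if "at r j v" for r j v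
    using that R(2)[of v j] by (auto simp: at_def E_def free_def)
  \<comment> \<open>The \<open>n - 5\<close> edges at \<open>v\<close> have distinct colours in
    \<open>free v\<close>, a set of \<open>n - 5\<close> rows, so each of these rows is
    used.\<close>
  have at_exists: "\<exists>j. at r j v" if "v \<in> V" "r \<in> U" "v \<notin> p r ` Q" for r v
  proof -
    let ?A = "{j. (v, j) \<in> E}"
    have "inj_on (\<lambda>j. R (v, j)) ?A" using proper_colouringD(1)[OF R(1)] by (auto simp: inj_on_def)
    then have "card ((\<lambda>j. R (v, j)) ` ?A) = card (free v)"
      using deg_v card_free that by (simp add: card_image)
    moreover have "(\<lambda>j. R (v, j)) ` ?A \<subseteq> free v" "finite (free v)"
      using R(2) fin by (auto simp: free_def)
    ultimately have "(\<lambda>j. R (v, j)) ` ?A = free v" using card_subset_eq by blast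
    moreover have "r \<in> free v" using that by (simp add: free_def)
    ultimately have "r \<in> (\<lambda>j. R (v, j)) ` ?A" by simp
    then show ?thesis by (auto simp: at_def)
  qed

  \<comment> \<open>The leftover graph and its 3-colouring\<close>
  \<comment> \<open>The filled cells with a symbol of \<open>T\<close> bring every row to degree
    exactly 3, and later they attach a symbol to each colour.\<close>
  define \<Lambda> where "\<Lambda> = {(r, j). r \<in> U \<and> (j \<in> J \<and> (\<nexists>v. at r j v) \<or> j \<in> Q \<and> p r j \<in> T)}"
  have "\<Lambda> \<subseteq> U \<times> N" using N_cols by (auto simp: \<Lambda>_def)
  then have fin_\<Lambda>: "finite \<Lambda>" using fin by (meson finite_SigmaI finite_subset)
  \<comment> \<open>Each column of \<open>X\<close> already holds a symbol outside \<open>T\<close>,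
    which leaves \<open>card X\<close> cells of the row in \<open>J\<close> empty; the remaining
    \<open>3 - card X\<close> cells in \<open>Q\<close> complete the count.\<close>
  have row_\<Lambda>: "card {j. (r, j) \<in> \<Lambda>} = 3" if r: "r \<in> U" for r
  proof -
    define A where "A = {v \<in> V. v \<notin> p r ` Q}"
    define X where "X = {q \<in> Q. p r q \<notin> T}"
    have rN: "r \<in> N" using r N_rows by auto
    have "\<forall>v\<in>A. \<exists>j. at r j v" using at_exists r by (simp add: A_def)
    then obtain \<gamma> where \<gamma>: "\<And>v. v \<in> A \<Longrightarrow> at r (\<gamma> v) v" by metis
    have "inj_on \<gamma> A"
    proof (rule inj_onI)
      fix v v' assume "v \<in> A" "v' \<in> A" "\<gamma> v = \<gamma> v'"
      then show "v = v'" using \<gamma>[of v] \<gamma>[of v'] at_unique(1) by simp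
    qed
    moreover have "\<gamma> ` A = {j \<in> J. \<exists>v. at r j v}"
    proof (intro equalityI subsetI)
      fix j assume "j \<in> \<gamma> ` A"
      then show "j \<in> {j \<in> J. \<exists>v. at r j v}" using \<gamma> at_V(2) by blast
    next
      fix j assume "j \<in> {j \<in> J. \<exists>v. at r j v}"
      then obtain v where v: "at r j v" by blast
      then have "v \<in> A" using at_V[OF v] by (simp add: A_def)
      then show "j \<in> \<gamma> ` A" using at_unique(2)[OF v \<gamma>] by blast
    qed
    ultimately have 1: "card {j \<in> J. \<exists>v. at r j v} = card A" by (metis card_image)
    have X: "p r ` X = p r ` Q \<inter> V"
      using rng[OF rN] N_cols by (auto simp: X_def V_def)
    have "inj_on (p r) X" using row_Q[OF rN] by (auto simp: X_def inj_on_def)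
    then have 2: "card (p r ` X) = card X" by (rule card_image)
    have "A = V - p r ` X" unfolding X by (auto simp: A_def)
    then have 3: "card A = n - 3 - card X" and 4: "card X \<le> n - 3"
      using 2 X fin card_V card_mono[OF fin(6), of "p r ` X"] by (simp_all add: card_Diff_subset)
    have "{j \<in> J. \<nexists>v. at r j v} = J - {j \<in> J. \<exists>v. at r j v}" by auto
    then have "card {j \<in> J. \<nexists>v. at r j v} = card J - card {j \<in> J. \<exists>v. at r j v}"
      using fin by (simp add: card_Diff_subset)
    then have 5: "card {j \<in> J. \<nexists>v. at r j v} = card X" using 1 3 4 cards by simp
    have "{j. (r, j) \<in> \<Lambda>} = {j \<in> J. \<nexists>v. at r j v} \<union> (Q - X)"
      using r by (auto simp: \<Lambda>_def X_def)
    moreover have "{j \<in> J. \<nexists>v. at r j v} \<inter> (Q - X) = {}" using N_cols by auto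
    ultimately have "card {j. (r, j) \<in> \<Lambda>} = card X + card (Q - X)"
      using fin 5 by (simp add: card_Un_disjoint)
    moreover have "X \<subseteq> Q" by (auto simp: X_def)
    ultimately show ?thesis using fin cards card_mono[OF fin(4), of X]
      by (simp add: card_Diff_subset finite_subset)
  qed
  \<comment> \<open>In a column of \<open>J\<close> all but \<open>n - 5\<close> of the
    \<open>n - 2\<close> cells remain; in a column of \<open>Q\<close> the cells counted carry
    distinct symbols of \<open>T\<close>.\<close>
  have col_\<Lambda>: "card {r. (r, j) \<in> \<Lambda>} \<le> 3" for j
  proof -
    consider "j \<in> J" | "j \<in> Q" | "j \<notin> N" using N_cols by auto
    then show ?thesis
    proof cases
      case 1
      let ?A = "{v. (v, j) \<in> E}"
      have "inj_on (\<lambda>v. R (v, j)) ?A" using proper_colouringD(2)[OF R(1)] by (auto simp: inj_on_def)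
      then have "card ((\<lambda>v. R (v, j)) ` ?A) = n - 5" using deg_j[OF 1] by (simp add: card_image)
      moreover have "{r. (r, j) \<in> \<Lambda>} = U - (\<lambda>v. R (v, j)) ` ?A"
        using 1 N_cols by (auto simp: \<Lambda>_def at_def)
      moreover have "(\<lambda>v. R (v, j)) ` ?A \<subseteq> U" using R(2) by (auto simp: free_def)
      ultimately have "card {r. (r, j) \<in> \<Lambda>} = n - 2 - (n - 5)"
        using fin cards by (metis card_Diff_subset finite_subset)
      then show ?thesis by simp
    next
      case 2
      let ?A = "{r. (r, j) \<in> \<Lambda>}"
      have A: "?A \<subseteq> N" using sub by (auto simp: \<Lambda>_def)
      have "inj_on (\<lambda>r. p r j) ?A"
      proof (rule inj_onI)
        fix r r' assume "r \<in> ?A" "r' \<in> ?A" "p r j = p r' j"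
        then show "r = r'" using col_inj[of r r' j] A 2 sub by blast
      qed
      moreover have "(\<lambda>r. p r j) ` ?A \<subseteq> T" using 2 N_cols(2) by (auto simp: \<Lambda>_def)
      ultimately show ?thesis using card_inj_on_le[OF _ _ fin(5)] card_T by metis
    next
      case 3
      then have "{r. (r, j) \<in> \<Lambda>} = {}" using N_cols by (auto simp: \<Lambda>_def)
      then show ?thesis by simp
    qed
  qed
  have "card {j. (r, j) \<in> \<Lambda>} \<le> 3" for r
    using row_\<Lambda>[of r] by (cases "r \<in> U") (auto simp: \<Lambda>_def)
  then obtain f where f: "proper_colouring \<Lambda> f" "\<And>e. e \<in> \<Lambda> \<Longrightarrow> f e < (3::nat)"
    using konig_edge_colouring[OF fin_\<Lambda> _ col_\<Lambda>] by blast
  have all_colours: "\<exists>j. (r, j) \<in> \<Lambda> \<and> f (r, j) = c" if "r \<in> U" "c < 3" for r c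
  proof -
    let ?A = "{j. (r, j) \<in> \<Lambda>}"
    have "inj_on (\<lambda>j. f (r, j)) ?A" using proper_colouringD(1)[OF f(1)] by (auto simp: inj_on_def)
    then have "card ((\<lambda>j. f (r, j)) ` ?A) = card {..<3::nat}" using row_\<Lambda>[OF that(1)] by (simp add: card_image)
    moreover have "(\<lambda>j. f (r, j)) ` ?A \<subseteq> {..<3}" using f(2) by auto
    ultimately have "(\<lambda>j. f (r, j)) ` ?A = {..<3}" by (intro card_subset_eq) auto
    then have "c \<in> (\<lambda>j. f (r, j)) ` ?A" using that(2) by simp
    then show ?thesis by auto
  qed
  \<comment> \<open>A colour class meets all \<open>n - 2\<close> rows of \<open>U\<close> in
    distinct columns, while \<open>J\<close> has only \<open>n - 3\<close> columns.\<close>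
  have corner_colour: "\<exists>r q. r \<in> U \<and> q \<in> Q \<and> p r q \<in> T \<and> f (r, q) = c" if c: "c < 3" for c
  proof (rule ccontr)
    assume no: "\<not> ?thesis"
    have "\<forall>r\<in>U. \<exists>j. (r, j) \<in> \<Lambda> \<and> f (r, j) = c" using all_colours c by simp
    from bchoice[OF this] obtain \<beta> where \<beta>: "\<And>r. r \<in> U \<Longrightarrow> (r, \<beta> r) \<in> \<Lambda> \<and> f (r, \<beta> r) = c"
      by blast
    then have "\<beta> ` U \<subseteq> J" using no by (auto simp: \<Lambda>_def)
    moreover have "inj_on \<beta> U"
    proof (rule inj_onI)
      fix r r' assume "r \<in> U" "r' \<in> U" "\<beta> r = \<beta> r'"
      then show "r = r'" using \<beta>[of r] \<beta>[of r'] proper_colouringD(2)[OF f(1), of r "\<beta> r" r'] by simp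
    qed
    ultimately have "card U \<le> card J" using fin by (meson card_inj_on_le)
    then show False using cards n by simp
  qed
  then have "\<forall>c. \<exists>t. c < 3 \<longrightarrow> (\<exists>r q. r \<in> U \<and> q \<in> Q \<and> p r q \<in> T \<and> t = p r q \<and> f (r, q) = c)"
    by blast
  from choice[OF this] obtain \<theta> where \<theta>: "\<And>c. c < 3 \<Longrightarrow> \<exists>r q. r \<in> U \<and> q \<in> Q \<and> p r q \<in> T \<and> \<theta> c = p r q \<and> f (r, q) = c"
    by blast
  \<comment> \<open>Two of the three occurrences of a symbol of \<open>T\<close> in columns 1, 2, 3 lie in rows 1 and 2.\<close>
  have T_unique: "r = r' \<and> q = q'"
    if *: "r \<in> U" "r' \<in> U" "q \<in> Q" "q' \<in> Q" "p r q \<in> T" "p r q = p r' q'" for r r' q q'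
  proof -
    obtain q1 q2 where q12: "q1 \<in> Q" "p 1 q1 = p r q" "q2 \<in> Q" "p 2 q2 = p r q"
      using *(5) T2 unfolding T_def by (metis imageE)
    have apart: "p i q' \<noteq> p 1 q'" "p i q' \<noteq> p 2 q'" if "i \<in> U" "q' \<in> Q" for i q'
    proof -
      have "i \<in> N" "q' \<in> N" "i \<noteq> 1" "i \<noteq> 2" using that sub N_rows(2) by blast+
      then show "p i q' \<noteq> p 1 q'" "p i q' \<noteq> p 2 q'"
        using col_inj[of i 1 q'] col_inj[of i 2 q'] in12 that by blast+
    qed
    have "q1 \<noteq> q2" using q12 col_inj[of 1 2 q1] in12 N_cols by auto
    moreover have "q \<noteq> q1" "q \<noteq> q2" "q' \<noteq> q1" "q' \<noteq> q2"
      using q12 * apart by metis+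
    ultimately have "q = q'" using q12 * unfolding Q_def by auto
    then show ?thesis using * col_inj[of r r' q] sub by blast
  qed
  have \<theta>_T: "\<theta> c \<in> T" if "c < 3" for c using \<theta>[OF that] by auto
  have \<theta>_inj: "c = c'" if "c < 3" "c' < 3" "\<theta> c = \<theta> c'" for c c'
    using \<theta>[OF that(1)] \<theta>[OF that(2)] that(3) T_unique by metis
  \<comment> \<open>If the symbol stood in row \<open>r\<close> within \<open>Q\<close>, that cell
    would be the one that named the colour, and two edges at \<open>r\<close> would share
    it.\<close>
  have \<theta>_row: "\<theta> (f (r, j)) \<notin> p r ` Q" if rj: "(r, j) \<in> \<Lambda>" "j \<in> J" for r j
  proof
    assume "\<theta> (f (r, j)) \<in> p r ` Q"
    then obtain q where q: "q \<in> Q" "\<theta> (f (r, j)) = p r q" by blast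
    obtain r' q' where q': "r' \<in> U" "q' \<in> Q" "p r' q' \<in> T" "\<theta> (f (r, j)) = p r' q'" "f (r', q') = f (r, j)"
      using \<theta>[OF f(2)[OF rj(1)]] by auto
    have "r \<in> U" using rj by (simp add: \<Lambda>_def)
    then have "r' = r" "q' = q" using T_unique[of r' r q' q] q q' by auto
    then have "(r, q) \<in> \<Lambda>" "f (r, q) = f (r, j)" using q q' \<open>r \<in> U\<close> by (auto simp: \<Lambda>_def)
    then have "q = j" using proper_colouringD(1)[OF f(1)] rj(1) by metis
    then show False using q rj N_cols by auto
  qed

  \<comment> \<open>Assembling the Latin square\<close>
  define L where "L r j = (if r \<in> {1, 2} \<or> j \<in> Q then p r j
    else if \<exists>v. at r j v then (THE v. at r j v) else \<theta> (f (r, j)))" for r j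
  have L_old: "L r j = p r j" if "r \<in> {1, 2} \<or> j \<in> Q" for r j using that by (simp add: L_def)
  have L_new: "at r j (L r j) \<or> (r, j) \<in> \<Lambda> \<and> L r j = \<theta> (f (r, j)) \<and> L r j \<in> T \<and> L r j \<notin> p r ` Q"
    if "r \<in> U" "j \<in> J" for r j
  proof (cases "\<exists>v. at r j v")
    case True
    then have "at r j (THE v. at r j v)" using at_unique(1) by (metis theI)
    then show ?thesis using True that N_rows N_cols by (auto simp: L_def)
  next
    case False
    then have "(r, j) \<in> \<Lambda>" using that by (simp add: \<Lambda>_def)
    moreover have "L r j = \<theta> (f (r, j))" using False that N_rows N_cols by (auto simp: L_def)
    ultimately show ?thesis using \<theta>_row \<theta>_T f(2) that by auto
  qed
  have L_notQ: "L r j \<notin> p r ` Q" if "r \<in> U" "j \<in> J" for r j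
    using L_new[OF that] at_V(4) by blast
  have L_rng: "L r j \<in> N" if "r \<in> N" "j \<in> N" for r j
  proof (cases "r \<in> {1, 2} \<or> j \<in> Q")
    case False
    then have "r \<in> U" "j \<in> J" using that N_rows N_cols by auto
    then show ?thesis using L_new at_V(1) TN V_def by blast
  qed (use that rng L_old in auto)
  have L_row: "j = j'" if *: "r \<in> N" "j \<in> N" "j' \<in> N" "L r j = L r j'" for r j j'
  proof (cases "r \<in> {1, 2}")
    case True
    then show ?thesis using * row_inj[of r j j'] by (simp add: L_old)
  next
    case False
    then have r: "r \<in> U" using * N_rows by auto
    consider "j \<in> Q" "j' \<in> Q" | "j \<in> Q" "j' \<in> J" | "j \<in> J" "j' \<in> Q" | "j \<in> J" "j' \<in> J"
      using * N_cols by auto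
    then show ?thesis
    proof cases
      case 1
      then show ?thesis using * row_inj[of r j j'] by (simp add: L_old)
    next
      case 2
      then show ?thesis using *(4) L_notQ[OF r 2(2)] L_old[of r j] by (metis imageI)
    next
      case 3
      then show ?thesis using *(4) L_notQ[OF r 3(1)] L_old[of r j'] by (metis imageI)
    next
      case 4
      \<comment> \<open>Whether the common symbol lies in \<open>T\<close> tells which of the two
        colourings placed both copies.\<close>
      show ?thesis
      proof (cases "L r j \<in> T")
        case True
        then have "(r, j) \<in> \<Lambda>" "(r, j') \<in> \<Lambda>" "\<theta> (f (r, j)) = \<theta> (f (r, j'))"
          using L_new[OF r 4(1)] L_new[OF r 4(2)] at_V(1) *(4) by (auto simp: V_def)
        moreover from this have "f (r, j) = f (r, j')" using \<theta>_inj f(2) by simp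
        ultimately show ?thesis using proper_colouringD(1)[OF f(1), of r j j'] by simp
      next
        case False
        then show ?thesis
          using L_new[OF r 4(1)] L_new[OF r 4(2)] at_unique(2)[of r j "L r j" j'] *(4) by simp
      qed
    qed
  qed
  have L_col: "r = r'" if *: "r \<in> N" "r' \<in> N" "j \<in> N" "L r j = L r' j" for r r' j
  proof (cases "j \<in> Q")
    case True
    then show ?thesis using * col_inj[of r r' j] by (simp add: L_old)
  next
    case False
    then have j: "j \<in> J" using * N_cols by auto
    have top: "p i j \<in> V" if "i \<in> {1, 2}" for i using pJ(1)[OF that] j by blast
    \<comment> \<open>Symbols placed by the list colouring avoid rows 1 and 2 by the choice of
      \<open>E\<close>; those of \<open>T\<close> do so because in \<open>J\<close> these rows show
      only symbols of \<open>V\<close>.\<close>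
    have avoid: "L i j \<noteq> p i' j" if "i \<in> U" "i' \<in> {1, 2}" for i i'
      using L_new[OF that(1) j] at_V(5,6) top[OF that(2)] that(2) by (auto simp: V_def)
    consider "r \<in> {1, 2}" "r' \<in> {1, 2}" | "r \<in> {1, 2}" "r' \<in> U" | "r \<in> U" "r' \<in> {1, 2}"
      | "r \<in> U" "r' \<in> U"
      using * N_rows by auto
    then show ?thesis
    proof cases
      case 1
      then show ?thesis using * col_inj[of r r' j] by (simp add: L_old)
    next
      case 2
      then show ?thesis using *(4) avoid[of r' r] by (simp add: L_old)
    next
      case 3
      then show ?thesis using *(4) avoid[of r r'] by (simp add: L_old)
    next
      case 4
      show ?thesis
      proof (cases "L r j \<in> T")
        case True
        then have "(r, j) \<in> \<Lambda>" "(r', j) \<in> \<Lambda>" "\<theta> (f (r, j)) = \<theta> (f (r', j))"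
          using L_new[OF 4(1) j] L_new[OF 4(2) j] at_V(1) *(4) by (auto simp: V_def)
        moreover from this have "f (r, j) = f (r', j)" using \<theta>_inj f(2) by simp
        ultimately show ?thesis using proper_colouringD(2)[OF f(1), of r j r'] by simp
      next
        case False
        then show ?thesis
          using L_new[OF 4(1) j] L_new[OF 4(2) j] at_colunique[of r j "L r j" r'] *(4) by simp
      qed
    qed
  qed
  have "latin_square n L"
    using L_rng L_row L_col unfolding latin_square_def N_def inj_on_def by blast
  moreover have "L i j = v" if "i \<in> N" "j \<in> N" "P i j = Some v" for i j v
  proof -
    have "i \<in> {1, 2} \<or> j \<in> Q" using filled[OF that(1,2)] that(3) by simp
    then show ?thesis using that(3) by (simp add: L_old p_def)
  qed
  ultimately show ?thesis unfolding completable_def N_def by blast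
qed

section \<open>From the cycle structure to the corner\<close>

text \<open>\<open>T\<close> is an orbit of the row permutation, hence closed under it. So the
  entries of row 2 below the symbols of \<open>T\<close> lie in \<open>T\<close> again, which is the
  corner condition.\<close>

theorem theorem7:
  fixes n k :: nat and P :: parr
  assumes "k \<ge> 3"
    and "PLS23 n P"
    and "T = {the (P 1 1), the (P 1 2), the (P 1 3)}"
    and "T \<in> perm_cycles n (row_perm n P)" and "card T = 3"
    and "\<forall>C \<in> perm_cycles n (row_perm n P). C = T \<or> (card C = 2 \<and> C \<inter> T = {})"
    and "card {C \<in> perm_cycles n (row_perm n P). card C = 2} = k + 2"
  shows "completable n P"
proof (rule completable_of_latin_corner[OF _ assms(2)])
  let ?s = "row_perm n P"
  \<comment> \<open>A crude bound gives \<open>3 \<le> n\<close>: there are at most \<open>n\<close>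
    orbits, and \<open>k + 2\<close> of them have two elements.\<close>
  have "finite (perm_cycles n ?s)" "card (perm_cycles n ?s) \<le> n"
    using card_image_le[of "{1..n}" "perm_orbit ?s"] by (simp_all add: perm_cycles_def)
  then have "k + 2 \<le> n"
    using card_mono[of "perm_cycles n ?s" "{C \<in> perm_cycles n ?s. card C = 2}"] assms(7) by simp
  then show n: "3 \<le> n" using assms(1) by simp
  have filled: "P r j \<noteq> None" if "r \<in> {1, 2}" "j \<in> {1..n}" for r j
  proof -
    have "r \<in> {1..n}" using that(1) n by auto
    then show ?thesis using assms(2) that unfolding PLS23_def by blast
  qed
  have inj: "j = j'" if "j \<in> {1..n}" "j' \<in> {1..n}" "P 1 j = P 1 j'" for j j'
  proof (rule ccontr)
    assume "j \<noteq> j'"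
    moreover have "1 \<in> {1..n}" using n by simp
    ultimately show False
      using assms(2) that filled[of 1 j] unfolding PLS23_def partial_latin_def by blast
  qed
  fix q :: nat assume q: "q \<in> {1, 2, 3}"
  then have qn: "q \<in> {1..n}" using n by auto
  obtain x where x: "P 1 q = Some x" using filled[of 1 q] qn by auto
  \<comment> \<open>Row 1 has no repeated entry, so the choice inside \<open>row_perm\<close> can
    only return \<open>q\<close>.\<close>
  have "(SOME i. i \<in> {1..n} \<and> P 1 i = Some x) = q"
    using qn x inj by (intro some_equality) auto
  then have s: "?s x = the (P 2 q)" using x qn unfolding row_perm_def by auto
  have "x \<in> T" using x q assms(3) by auto
  moreover obtain y where "T = perm_orbit ?s y" using assms(4) by (auto simp: perm_cycles_def)
  ultimately obtain m where "T = perm_orbit ?s y" "x = (?s ^^ m) y" unfolding perm_orbit_def by blast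
  then have "?s x \<in> T" unfolding perm_orbit_def by (auto intro!: exI[of _ "Suc m"])
  then obtain q' where q': "q' \<in> {1, 2, 3}" "the (P 2 q) = the (P 1 q')"
    using assms(3) s by auto
  then have "q' \<in> {1..n}" using n by auto
  then have "P 2 q = P 1 q'" using q'(2) filled[of 2 q] filled[of 1 q'] qn
    by (metis insertCI option.expand)
  then show "P 2 q \<in> P 1 ` {1, 2, 3}" using q'(1) by blast
qed

end
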